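(* Let $\mathbb{P}$ be generated by a PLSEM and let $F\in\mathcal{F}(\mathbb{P})$. Then there exists a set $\mathcal{O}\subseteq\{O\in\mathbb{R}^{p\times p}: OO^t=\mathrm{Id}\}$ of constant orthogonal matrices such that $\mathcal{F}(\mathbb{P})=\{x\mapsto O\,F(x):\ O\in\mathcal{O}\}$.
   Context: A PLSEM with DAG $D$ on $\{1,\dots,p\}$ is a system $X_j=\mu_j+\sum_{i\in\mathrm{pa}_D(j)} f_{j,i}(X_i)+\varepsilon_j$, $j=1,\dots,p$, where $\mu_j\in\mathbb{R}$, $f_{j,i}\in C^2(\mathbb{R})$, $f_{j,i}\not\equiv 0$, $\mathbb{E}[f_{j,i}(X_i)]=0$, and $\varepsilon_1,\dots,\varepsilon_p$ are mutually independent with $\varepsilon_j\sim\mathcal{N}(0,\sigma_j^2)$, $\sigma_j^2>0$; the distribution of the solution $X$ is said to be generated by the PLSEM. The PLSEM-function of such a PLSEM is $F:\mathbb{R}^p\to\mathbb{R}^p$, $F(x)_j=\frac{1}{\sigma_j}\big(x_j-\mu_j-\sum_{i\in\mathrm{pa}_D(j)}f_{j,i}(x_i)\big)$. $\mathcal{F}(\mathbb{P})$ denotes the set of PLSEM-functions of all PLSEMs that generate $\mathbb{P}$. *)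

theory Defs
  imports "HOL-Probability.Probability"
begin

definition C2 :: "(real \<Rightarrow> real) \<Rightarrow> bool" where
  "C2 g \<longleftrightarrow> (\<exists>g' g''. (\<forall>x. (g has_real_derivative g' x) (at x)) \<and>
                      (\<forall>x. (g' has_real_derivative g'' x) (at x)) \<and>
                      continuous_on UNIV g'')"

text \<open>A PLSEM over the finite index type 'n (playing the role of {1..p}).
  An edge (i,j) in dag means i is a parent of j.  fns j i is f_{j,i}, sig j is sigma_j
  (the standard deviation, so the noise variance is sig j ^ 2).\<close>
record 'n plsem =
  dag :: "('n \<times> 'n) set"
  mu  :: "'n \<Rightarrow> real"
  fns :: "'n \<Rightarrow> 'n \<Rightarrow> real \<Rightarrow> real"
  sig :: "'n \<Rightarrow> real"

definition pa :: "'n plsem \<Rightarrow> 'n \<Rightarrow> 'n set" where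
  "pa S j = {i. (i, j) \<in> dag S}"

definition plsem_wf :: "'n plsem \<Rightarrow> bool" where
  "plsem_wf S \<longleftrightarrow> acyclic (dag S) \<and>
     (\<forall>j. sig S j > 0) \<and>
     (\<forall>i j. (i, j) \<in> dag S \<longrightarrow> C2 (fns S j i) \<and> fns S j i \<noteq> (\<lambda>_. 0))"

text \<open>The distribution P (a measure on real^'n) is generated by the PLSEM S:
  there are mutually independent Gaussian noises eps_j ~ N(0, sig_j^2) and a solution X
  of the structural equations, with E[f_{j,i}(X_i)] = 0 for all edges, and P is the law of X.
  The sample space is taken to be real^'n (no loss of generality).\<close>
definition generates :: "('n::finite) plsem \<Rightarrow> (real^'n) measure \<Rightarrow> bool" where
  "generates S P \<longleftrightarrow> plsem_wf S \<and>
     (\<exists>(M :: (real^'n) measure) (eps :: 'n \<Rightarrow> real^'n \<Rightarrow> real) (X :: real^'n \<Rightarrow> real^'n).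
        prob_space M \<and>
        prob_space.indep_vars M (\<lambda>_. borel) eps UNIV \<and>
        (\<forall>j. eps j \<in> borel_measurable M \<and>
             distr M lborel (eps j) = density lborel (normal_density 0 (sig S j))) \<and>
        X \<in> borel_measurable M \<and>
        (\<forall>\<omega>\<in>space M. \<forall>j. X \<omega> $ j =
            mu S j + (\<Sum>i\<in>pa S j. fns S j i (X \<omega> $ i)) + eps j \<omega>) \<and>
        (\<forall>i j. (i, j) \<in> dag S \<longrightarrow>
            integrable M (\<lambda>\<omega>. fns S j i (X \<omega> $ i)) \<and>
            (\<integral>\<omega>. fns S j i (X \<omega> $ i) \<partial>M) = 0) \<and>
        P = distr M borel X)"

definition generated_by_plsem :: "(real^'n::finite) measure \<Rightarrow> bool" where
  "generated_by_plsem P \<longleftrightarrow> (\<exists>S. generates S P)"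

definition plsem_fun :: "('n::finite) plsem \<Rightarrow> real^'n \<Rightarrow> real^'n" where
  "plsem_fun S x = (\<chi> j. (x $ j - mu S j - (\<Sum>i\<in>pa S j. fns S j i (x $ i))) / sig S j)"

definition plsem_funs :: "(real^'n::finite) measure \<Rightarrow> (real^'n \<Rightarrow> real^'n) set" where
  "plsem_funs P = {plsem_fun S | S. generates S P}"

end

theory Submission
  imports Defs
begin

text \<open>A PLSEM is a volume-preserving triangular change of variables from the noise to \<open>X\<close>, so \<open>P\<close> has
  a continuous density proportional to \<open>exp (- |F x|\<^sup>2 / 2)\<close> for every PLSEM-function \<open>F\<close>.
  Hence two PLSEM-functions \<open>F\<close>, \<open>G\<close> of \<open>P\<close> satisfy \<open>|F x|\<^sup>2 = |G x|\<^sup>2 + d\<close>. Both are sums of curves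
  \<open>A\<^sub>k (x\<^sub>k)\<close> and \<open>B\<^sub>k (x\<^sub>k)\<close>, up to constants, and mixed finite differences of this identity give
  \<open>A\<^sub>i s \<bullet> A\<^sub>j t = B\<^sub>i s \<bullet> B\<^sub>j t\<close> for \<open>i \<noteq> j\<close>. The triangular shapes of \<open>F\<close> and \<open>G\<close>, with respect
  to possibly different DAGs, force the same for \<open>i = j\<close>. Equal Gram matrices of the curves then
  yield an orthogonal map that takes \<open>A\<^sub>k t\<close> to \<open>B\<^sub>k t\<close>, and \<open>F\<close> to \<open>G\<close>.\<close>

section \<open>Additive triangular maps with equal norms\<close>

text \<open>By bilinearity the condition cuts out a subspace in each argument, so two span
  inductions suffice. A span of pairs serves as a linear correspondence between two spaces that can
  be used before it is known to be single-valued.\<close>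

lemma span_pairs_inner:
  fixes T T' :: "('a::real_inner \<times> 'b::real_inner) set"
  assumes gen: "\<And>p q. p \<in> T \<Longrightarrow> q \<in> T' \<Longrightarrow> fst p \<bullet> fst q = snd p \<bullet> snd q"
    and "p \<in> span T" "q \<in> span T'"
  shows "fst p \<bullet> fst q = snd p \<bullet> snd q"
proof -
  have 1: "fst p \<bullet> fst q = snd p \<bullet> snd q" if "q \<in> T'" for q
    by (rule span_induct[OF \<open>p \<in> span T\<close>])
      (auto simp: subspace_def inner_add_left gen that)
  show ?thesis
    by (rule span_induct[OF \<open>q \<in> span T'\<close>])
      (auto simp: subspace_def inner_add_right 1)
qed

lemma span_inner_zero:
  fixes v :: "'a::real_inner"
  assumes "x \<in> span S" and "\<And>y. y \<in> S \<Longrightarrow> v \<bullet> y = 0"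
  shows "v \<bullet> x = 0"
  by (rule span_induct[OF assms(1)]) (auto simp: subspace_def inner_add_right assms(2))

lemma span_pairs_fst:
  assumes "v \<in> span (fst ` T)"
  obtains w where "(v, w) \<in> span T"
proof -
  have "v \<in> fst ` span T"
    using assms linear_span_image[OF linear_fst] by metis
  then show thesis using that by auto
qed

lemma span_pairs_snd: "(v, w) \<in> span T \<Longrightarrow> w \<in> span (snd ` T)"
  using linear_span_image[OF linear_snd, of T] by (metis imageI snd_conv)

section \<open>Families of curves that are triangular along a DAG\<close>

definition triangular :: "('n::finite \<times> 'n) set \<Rightarrow> ('n \<Rightarrow> real \<Rightarrow> real^'n) \<Rightarrow> bool" where
  "triangular r A \<longleftrightarrow> acyclic r \<and>
     (\<forall>k. \<exists>c. c \<noteq> 0 \<and> (\<forall>t. A k t - (c * t) *\<^sub>R axis k 1 \<in> span ((\<lambda>j. axis j 1) ` r `` {k})))"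

lemma triangularE:
  assumes "triangular r A"
  obtains c where "c \<noteq> 0" "\<And>t. A k t - (c * t) *\<^sub>R axis k 1 \<in> span ((\<lambda>j. axis j 1) ` r `` {k})"
  using assms unfolding triangular_def by meson

lemma triangular_wf:
  fixes r :: "('n::finite \<times> 'n) set"
  assumes "triangular r A"
  shows "wf ((r\<inverse>)\<^sup>+)"
  using assms by (auto simp: triangular_def intro!: wf_trancl finite_acyclic_wf)

text \<open>Back-substitution starting from the sinks: \<open>A k 1\<close> is a nonzero multiple of
  \<open>axis k 1\<close> plus a combination of the axes of the children of \<open>k\<close>, which
  the induction has already produced. Closedness of \<open>K\<close> keeps the children inside
  \<open>K\<close>.\<close>

lemma triangular_axis_in_span:
  fixes A :: "'n::finite \<Rightarrow> real \<Rightarrow> real^'n"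
  assumes tri: "triangular r A" and closed: "r `` K \<subseteq> K" and "k \<in> K"
  shows "axis k 1 \<in> span {A j t | j t. j \<in> K}"
  using \<open>k \<in> K\<close>
proof (induction k rule: wf_induct_rule[OF triangular_wf[OF tri]])
  case (1 k)
  obtain c where c: "c \<noteq> 0" "\<And>t. A k t - (c * t) *\<^sub>R axis k 1 \<in> span ((\<lambda>j. axis j 1) ` r `` {k})"
    using triangularE[OF tri] by blast
  have "(\<lambda>j. axis j 1) ` r `` {k} \<subseteq> span {A j t | j t. j \<in> K}"
    using 1 closed by (auto intro!: 1)
  from span_minimal[OF this subspace_span]
  have "A k 1 - c *\<^sub>R axis k 1 \<in> span {A j t | j t. j \<in> K}"
    using c(2)[of 1] by auto
  moreover have "A k 1 \<in> span {A j t | j t. j \<in> K}"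
    using 1 by (intro span_base) auto
  ultimately have "A k 1 - (A k 1 - c *\<^sub>R axis k 1) \<in> span {A j t | j t. j \<in> K}"
    by (rule span_diff[rotated])
  then have "c *\<^sub>R axis k 1 \<in> span {A j t | j t. j \<in> K}"
    by simp
  from span_scale[OF this, of "1 / c"] show ?case using \<open>c \<noteq> 0\<close> by simp
qed

lemma triangular_span_descendants:
  fixes A :: "'n::finite \<Rightarrow> real \<Rightarrow> real^'n"
  assumes tri: "triangular r A"
  shows "span ((\<lambda>j. axis j 1) ` r `` {i}) \<subseteq> span {A j t | j t. (i, j) \<in> r\<^sup>+}"
proof (intro span_minimal subspace_span subsetI)
  fix x :: "real^'n" assume "x \<in> (\<lambda>j. axis j 1) ` r `` {i}"
  then obtain j where j: "(i, j) \<in> r" "x = axis j 1" by auto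
  then show "x \<in> span {A j t | j t. (i, j) \<in> r\<^sup>+}"
    using triangular_axis_in_span[OF tri, of "{j. (i, j) \<in> r\<^sup>+}" j]
    by (auto intro: trancl_into_trancl)
qed

lemma triangular_span_UNIV:
  fixes A :: "'n::finite \<Rightarrow> real \<Rightarrow> real^'n"
  assumes tri: "triangular r A"
  shows "span {A j t | j t. True} = UNIV"
proof -
  have "axis k 1 \<in> span {A j t | j t. True}" for k
    using triangular_axis_in_span[OF tri, of UNIV k] by simp
  then have "Basis \<subseteq> span {A j t | j t. True}"
    by (auto simp: Basis_vec_def)
  then have "span Basis \<subseteq> span {A j t | j t. True}"
    by (intro span_minimal subspace_span)
  then show ?thesis by (metis span_Basis top.extremum_unique)
qed

text \<open>Induction on the DAG \<open>r\<close>, descendants first. Split off the components \<open>v s\<close> and \<open>w s\<close> of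
  \<open>A i s\<close> and \<open>B i s\<close> that correspond to each other in the spans of the descendants of \<open>i\<close>; what
  remains of \<open>A i s\<close> is linear in \<open>s\<close>. The remainder \<open>C s\<close> on the other side is linear too,
  because \<open>C s - s *\<^sub>R C 1\<close> is orthogonal to all \<open>B k t\<close> with \<open>k \<noteq> i\<close> but also lies in their
  span, the triangular shape of \<open>B\<close> putting \<open>B i s - s *\<^sub>R B i 1\<close> there.\<close>

lemma triangular_diagonal_inner:
  fixes A B :: "'n::finite \<Rightarrow> real \<Rightarrow> real^'n"
  assumes triA: "triangular r A" and triB: "triangular r' B"
    and off: "\<And>i j s t. i \<noteq> j \<Longrightarrow> A i s \<bullet> A j t = B i s \<bullet> B j t"
    and quad: "\<And>i s. 2 * (a \<bullet> A i s) + A i s \<bullet> A i s = 2 * (b \<bullet> B i s) + B i s \<bullet> B i s"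
  shows "A i s \<bullet> A i t = B i s \<bullet> B i t"
proof (induction i arbitrary: s t rule: wf_induct_rule[OF triangular_wf[OF triA]])
  case (1 i)
  let ?K = "{k. (i, k) \<in> r\<^sup>+}"
  let ?T = "{(A k t, B k t) | k t. k \<in> ?K}"
  let ?e = "axis i 1 :: real^'n"
  have iK: "i \<notin> ?K" and ir': "(i, i) \<notin> r'\<^sup>+"
    using triA triB by (auto simp: triangular_def acyclic_def)
  have IH: "A k s \<bullet> A k t = B k s \<bullet> B k t" if "(i, k) \<in> r\<^sup>+" for k s t
    using 1 that by (simp add: trancl_converse)
  obtain c where c: "c \<noteq> 0" "\<And>t. A i t - (c * t) *\<^sub>R ?e \<in> span ((\<lambda>j. axis j 1) ` r `` {i})"
    using triangularE[OF triA] by blast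
  define v where "v s = A i s - (c * s) *\<^sub>R ?e" for s
  have "\<exists>w. (v s, w) \<in> span ?T" for s
  proof -
    have "fst ` ?T = {A j t | j t. (i, j) \<in> r\<^sup>+}" by force
    then have "v s \<in> span (fst ` ?T)"
      using c(2)[of s] triangular_span_descendants[OF triA, of i] by (auto simp: v_def)
    then show ?thesis by (rule span_pairs_fst) blast
  qed
  then have "\<exists>w. \<forall>s. (v s, w s) \<in> span ?T" by (intro choice allI)
  then obtain w where w: "\<And>s. (v s, w s) \<in> span ?T" by blast
  define C where "C s = B i s - w s" for s
  have A_eq: "A i s = v s + (c * s) *\<^sub>R ?e" and B_eq: "B i s = w s + C s" for s
    by (simp_all add: v_def C_def)
  \<comment> \<open>One factor comes from a descendant \<open>j\<close> of \<open>i\<close>, so the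
    induction hypothesis settles \<open>k = j\<close> and \<open>off\<close> every other
    \<open>k\<close>, including \<open>k = i\<close>.\<close>
  have T_gram: "fst p \<bullet> A k t = snd p \<bullet> B k t" if pT: "p \<in> ?T" for p k t
  proof -
    obtain j u where p: "p = (A j u, B j u)" and j: "(i, j) \<in> r\<^sup>+" using pT by blast
    show ?thesis using IH[OF j] off[of j k] p by (cases "j = k") auto
  qed
  have vA: "v s \<bullet> A k t = w s \<bullet> B k t" for s k t
    using span_pairs_inner[OF _ w span_base[OF singletonI], of "(A k t, B k t)" s]
    by (simp add: T_gram)
  have vv: "v s \<bullet> v t = w s \<bullet> w t" for s t
  proof -
    have "fst p \<bullet> fst q = snd p \<bullet> snd q" if "p \<in> ?T" "q \<in> ?T" for p q
    proof -
      obtain k t where "q = (A k t, B k t)" using \<open>q \<in> ?T\<close> by blast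
      then show ?thesis using T_gram[OF \<open>p \<in> ?T\<close>] by simp
    qed
    from span_pairs_inner[OF this w w] show ?thesis by simp
  qed
  \<comment> \<open>On descendants the induction hypothesis cancels the squares in
    \<open>quad\<close>, leaving an identity that is linear in the curve and so extends to the span
    of \<open>?T\<close>.\<close>
  have va: "a \<bullet> v s = b \<bullet> w s" for s
  proof -
    have "a \<bullet> A k t = b \<bullet> B k t" if "(i, k) \<in> r\<^sup>+" for k t
      using quad[of k t] IH[OF that, of t t] by simp
    then have ab: "fst p \<bullet> fst q = snd p \<bullet> snd q" if "p \<in> ?T" "q \<in> {(a, b)}" for p q
      using that by (auto simp: inner_commute)
    have "fst (v s, w s) \<bullet> fst (a, b) = snd (v s, w s) \<bullet> snd (a, b)"
      by (rule span_pairs_inner[where T' = "{(a, b)}", OF ab w]) (simp_all only: span_base singletonI)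
    then show ?thesis by (simp add: inner_commute)
  qed
  have ev: "?e \<bullet> v s = 0" for s
  proof (rule span_inner_zero)
    show "v s \<in> span ((\<lambda>j. axis j 1) ` r `` {i})" using c(2) by (simp add: v_def)
    show "?e \<bullet> y = 0" if "y \<in> (\<lambda>j. axis j 1) ` r `` {i}" for y
      using that iK by (auto simp: inner_axis_axis)
  qed
  \<comment> \<open>Expand \<open>v s \<bullet> A i t = w s \<bullet> B i t\<close> along both
    decompositions: \<open>v s\<close> is orthogonal to \<open>?e\<close>, and \<open>vv\<close>
    cancels the rest.\<close>
  have wC: "w s \<bullet> C t = 0" for s t
    using vA[of s i t] vv[of s t] ev[of s]
    by (simp add: C_def A_eq inner_diff_right inner_add_right inner_commute)
  have C_lin: "C s = s *\<^sub>R C 1" for s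
  proof -
    define D where "D = C s - s *\<^sub>R C 1"
    have "D \<bullet> B k t = 0" if "k \<noteq> i" for k t
    proof -
      have "C s \<bullet> B k t = (c * s) * (?e \<bullet> A k t)" for s
        using vA[of s k t] off[of i k s t] that
        by (simp add: C_def A_eq inner_diff_left inner_add_left)
      then show ?thesis by (simp add: D_def inner_diff_left)
    qed
    then have orth: "D \<bullet> y = 0" if "y \<in> {B k t | k t. k \<noteq> i}" for y using that by auto
    have w_in: "w s \<in> span {B k t | k t. k \<noteq> i}" for s
    proof -
      have "snd ` ?T \<subseteq> {B k t | k t. k \<noteq> i}" using iK by clarsimp blast
      then show ?thesis using span_pairs_snd[OF w] span_mono by blast
    qed
    have B_in: "B i s - s *\<^sub>R B i 1 \<in> span {B k t | k t. k \<noteq> i}"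
    proof -
      obtain d where d: "\<And>t. B i t - (d * t) *\<^sub>R ?e \<in> span ((\<lambda>j. axis j 1) ` r' `` {i})"
        using triangularE[OF triB] by blast
      have "(B i s - (d * s) *\<^sub>R ?e) - s *\<^sub>R (B i 1 - (d * 1) *\<^sub>R ?e)
          \<in> span ((\<lambda>j. axis j 1) ` r' `` {i})"
        by (intro span_diff span_scale d)
      then have "B i s - s *\<^sub>R B i 1 \<in> span ((\<lambda>j. axis j 1) ` r' `` {i})"
        by (simp add: algebra_simps)
      then have "B i s - s *\<^sub>R B i 1 \<in> span {B j t | j t. (i, j) \<in> r'\<^sup>+}"
        using triangular_span_descendants[OF triB] by blast
      moreover have "{B j t | j t. (i, j) \<in> r'\<^sup>+} \<subseteq> {B k t | k t. k \<noteq> i}"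
        using ir' by blast
      ultimately show ?thesis using span_mono by blast
    qed
    have "D = (B i s - s *\<^sub>R B i 1) - w s + s *\<^sub>R w 1"
      by (simp add: D_def C_def algebra_simps)
    then have "D \<in> span {B k t | k t. k \<noteq> i}"
      using w_in B_in by (auto intro!: span_add span_diff span_scale)
    then have "D \<bullet> D = 0" by (rule span_inner_zero) (rule orth)
    then show ?thesis by (simp add: D_def)
  qed
  have AA: "A i s \<bullet> A i t = v s \<bullet> v t + c\<^sup>2 * s * t" for s t
    using ev[of s] ev[of t]
    by (simp add: A_eq inner_add_left inner_add_right inner_commute power2_eq_square inner_axis_axis)
  have BB: "B i s \<bullet> B i t = w s \<bullet> w t + (C 1 \<bullet> C 1) * s * t" for s t
  proof -
    have "B i u = w u + u *\<^sub>R C 1" for u using B_eq[of u] C_lin[of u] by simp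
    then show ?thesis using wC[of s 1] wC[of t 1]
      by (simp add: inner_add_left inner_add_right inner_commute)
  qed
  have q: "2 * c * s * (a \<bullet> ?e) + c\<^sup>2 * s * s = 2 * s * (b \<bullet> C 1) + (C 1 \<bullet> C 1) * s * s" for s
  proof -
    have "a \<bullet> A i s = a \<bullet> v s + (c * s) * (a \<bullet> ?e)"
      by (simp add: A_eq inner_add_right)
    moreover have "b \<bullet> B i s = b \<bullet> w s + s * (b \<bullet> C 1)"
      using C_lin[of s] by (metis B_eq inner_add_right inner_scaleR_right)
    ultimately show ?thesis
      using quad[of i s] va[of s] vv[of s s] AA[of s s] BB[of s s] by simp
  qed
  \<comment> \<open>Adding the two instances removes the terms linear in \<open>s\<close> and
    compares the quadratic coefficients.\<close>
  have "c\<^sup>2 = C 1 \<bullet> C 1" using q[of 1] q[of "-1"] by simp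
  then show ?case by (simp add: AA BB vv)
qed

text \<open>\<open>span T\<close> is the graph of the required map. Every vector occurs as a first
  component, and a pair \<open>(0, w)\<close> in the span has \<open>w \<bullet> w = 0\<close>, so
  the partner is unique; linearity holds because the span is a subspace.\<close>

lemma spanning_pairs_orthogonal:
  fixes T :: "('a::euclidean_space \<times> 'a) set"
  assumes gram: "\<And>p q. p \<in> T \<Longrightarrow> q \<in> T \<Longrightarrow> fst p \<bullet> fst q = snd p \<bullet> snd q"
    and span: "span (fst ` T) = UNIV"
  obtains U where "orthogonal_transformation U" "\<And>p. p \<in> T \<Longrightarrow> U (fst p) = snd p"
proof -
  have "\<exists>w. (v, w) \<in> span T" for v using span_pairs_fst[of v T] span by auto
  then obtain U where U: "\<And>v. (v, U v) \<in> span T" by metis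
  have uniq: "w = U v" if "(v, w) \<in> span T" for v w
  proof -
    have "(v, w) - (v, U v) \<in> span T" using that U by (rule span_diff)
    then have "(0, w - U v) \<in> span T" by simp
    from span_pairs_inner[OF gram this this] show ?thesis by simp
  qed
  have "linear U"
  proof (rule linearI)
    show "U (x + y) = U x + U y" for x y
      using span_add[OF U[of x] U[of y]] uniq by simp
    show "U (c *\<^sub>R x) = c *\<^sub>R U x" for c x
      using span_scale[OF U[of x], of c] uniq by simp
  qed
  moreover have "U x \<bullet> U y = x \<bullet> y" for x y
    using span_pairs_inner[OF gram U U, of x y] by simp
  ultimately have "orthogonal_transformation U"
    by (simp add: orthogonal_transformation_def)
  moreover have "U (fst p) = snd p" if "p \<in> T" for p
    using uniq[of "fst p" "snd p"] span_base[OF that] by simp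
  ultimately show thesis by (rule that)
qed

section \<open>Maps that are sums of functions of single coordinates\<close>

definition additive_in_coords :: "(real^'n::finite \<Rightarrow> real^'n) \<Rightarrow> bool" where
  "additive_in_coords F \<longleftrightarrow> (\<forall>x. F x = F 0 + (\<Sum>k\<in>UNIV. F (axis k (x $ k)) - F 0))"

lemma axis_0: "axis k 0 = (0 :: real^'n)"
  by (simp add: axis_def vec_eq_iff)

lemma axis_nth_other: "k \<noteq> i \<Longrightarrow> axis i s $ k = (0 :: real)"
  by (simp add: axis_def)

lemma additive_in_coords_two:
  fixes F :: "real^'n::finite \<Rightarrow> real^'n"
  assumes add: "additive_in_coords F" and "i \<noteq> j"
  shows "F (axis i s + axis j t) = F (axis i s) + F (axis j t) - F 0"
proof -
  have "F (axis i s + axis j t) =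
      F 0 + (\<Sum>k\<in>UNIV. F (axis k ((axis i s + axis j t) $ k)) - F 0)"
    using add unfolding additive_in_coords_def by blast
  also have "(\<Sum>k\<in>UNIV. F (axis k ((axis i s + axis j t) $ k)) - F 0) =
      (\<Sum>k\<in>{i, j}. F (axis k ((axis i s + axis j t) $ k)) - F 0)"
  proof (rule sum.mono_neutral_right)
    show "\<forall>k\<in>UNIV - {i, j}. F (axis k ((axis i s + axis j t) $ k)) - F 0 = 0"
      by (simp add: axis_nth_other axis_0)
  qed auto
  also have "\<dots> = (F (axis i s) - F 0) + (F (axis j t) - F 0)"
    using \<open>i \<noteq> j\<close> by (simp add: axis_nth_other)
  finally show ?thesis by simp
qed

lemma triangular_additive_orthogonal:
  fixes F G :: "real^'n::finite \<Rightarrow> real^'n"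
  assumes addF: "additive_in_coords F" and addG: "additive_in_coords G"
    and triF: "triangular r (\<lambda>k t. F (axis k t) - F 0)"
    and triG: "triangular r' (\<lambda>k t. G (axis k t) - G 0)"
    and norms: "\<And>x. F x \<bullet> F x = G x \<bullet> G x + d"
  obtains U where "orthogonal_transformation U" "\<And>x. G x = U (F x)"
proof -
  define A where "A k t = F (axis k t) - F 0" for k t
  define B where "B k t = G (axis k t) - G 0" for k t
  have triA: "triangular r A" and triB: "triangular r' B"
    using triF triG by (simp_all add: A_def[abs_def] B_def[abs_def])
  \<comment> \<open>The norm identity at a point of the axis minus the one at the origin; the
    constant \<open>d\<close> cancels.\<close>
  have quad: "2 * (F 0 \<bullet> A i s) + A i s \<bullet> A i s = 2 * (G 0 \<bullet> B i s) + B i s \<bullet> B i s" for i s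
    using norms[of "axis i s"] norms[of 0]
    by (simp add: A_def B_def inner_diff_left inner_diff_right inner_commute)
  have off: "A i s \<bullet> A j t = B i s \<bullet> B j t" if "i \<noteq> j" for i j s t
  proof -
    have "F (axis i s + axis j t) = F 0 + A i s + A j t"
      using additive_in_coords_two[OF addF that, of s t] by (simp add: A_def)
    moreover have "G (axis i s + axis j t) = G 0 + B i s + B j t"
      using additive_in_coords_two[OF addG that, of s t] by (simp add: B_def)
    ultimately show ?thesis
      using norms[of "axis i s + axis j t"] norms[of 0] quad[of i s] quad[of j t]
      by (simp add: inner_add_left inner_add_right inner_commute)
  qed
  have gram: "A i s \<bullet> A j t = B i s \<bullet> B j t" for i j s t
    using off triangular_diagonal_inner[OF triA triB off quad] by (cases "i = j") auto
  let ?T = "{(A k t, B k t) | k t. True}"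
  have T_gram: "fst p \<bullet> fst q = snd p \<bullet> snd q" if "p \<in> ?T" "q \<in> ?T" for p q
    using that gram by auto
  have "fst ` ?T = {A k t | k t. True}" by force
  then have "span (fst ` ?T) = UNIV" using triangular_span_UNIV[OF triA] by simp
  then obtain U where U: "orthogonal_transformation U" and "\<And>p. p \<in> ?T \<Longrightarrow> U (fst p) = snd p"
    using spanning_pairs_orthogonal[of ?T] gram by (metis (no_types, lifting) T_gram)
  then have UA: "U (A k t) = B k t" for k t by force
  \<comment> \<open>With equal squares, \<open>quad\<close> reduces to
    \<open>F 0 \<bullet> A k t = G 0 \<bullet> B k t\<close>. Since the curves \<open>B\<close> span
    the space, this determines \<open>G 0\<close>.\<close>
  have "(G 0 - U (F 0)) \<bullet> B k t = 0" for k t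
  proof -
    have "U (F 0) \<bullet> B k t = F 0 \<bullet> A k t"
      using U by (metis UA orthogonal_transformation_def)
    then show ?thesis using quad[of k t] gram[of k t k t] by (simp add: inner_diff_left)
  qed
  then have "(G 0 - U (F 0)) \<bullet> (G 0 - U (F 0)) = 0"
    using span_inner_zero[of "G 0 - U (F 0)" "{B k t | k t. True}" "G 0 - U (F 0)"]
      triangular_span_UNIV[OF triB] by auto
  then have U0: "U (F 0) = G 0" by simp
  have "G x = U (F x)" for x
  proof -
    have lin: "linear U" using U by (simp add: orthogonal_transformation_def)
    have "F x = F 0 + (\<Sum>k\<in>UNIV. A k (x $ k))" "G x = G 0 + (\<Sum>k\<in>UNIV. B k (x $ k))"
      using addF addG unfolding additive_in_coords_def A_def B_def by blast+
    then show ?thesis by (simp only: linear_add[OF lin] linear_sum[OF lin] U0 UA)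
  qed
  with U show thesis by (rule that)
qed

section \<open>The density of a PLSEM\<close>

abbreviation lebesgue_prod :: "('n::finite \<Rightarrow> real) measure" where
  "lebesgue_prod \<equiv> \<Pi>\<^sub>M i\<in>UNIV. lborel"

lemma product_sigma_finite_lborel: "product_sigma_finite (\<lambda>_::'n::finite. lborel :: real measure)"
  by (simp add: product_sigma_finite_def sigma_finite_lborel)

lemma sigma_finite_lebesgue_prod: "sigma_finite_measure (lebesgue_prod :: ('n::finite \<Rightarrow> real) measure)"
proof -
  interpret product_sigma_finite "\<lambda>_::'n. lborel :: real measure" by (rule product_sigma_finite_lborel)
  interpret finite_product_sigma_finite "\<lambda>_::'n. lborel :: real measure" UNIV by standard simp
  show ?thesis by (rule sigma_finite_measure_axioms)
qed

lemma measurable_lebesgue_prodI: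
  assumes "\<And>i. (\<lambda>x. f x i) \<in> borel_measurable N"
  shows "f \<in> measurable N (lebesgue_prod :: ('n::finite \<Rightarrow> real) measure)"
  using measurable_PiM_single'[of UNIV "\<lambda>i x. f x i" N "\<lambda>_. lborel"] assms by simp

text \<open>The measurable left inverse \<open>\<Psi>\<close> will recover X from the noise.
  Preservation of Lebesgue measure replaces a Jacobian computation, so densities transform by mere
  composition.\<close>

definition volume_iso :: "(('n::finite \<Rightarrow> real) \<Rightarrow> 'n \<Rightarrow> real) \<Rightarrow> bool" where
  "volume_iso E \<longleftrightarrow> E \<in> measurable lebesgue_prod lebesgue_prod \<and>
     distr lebesgue_prod lebesgue_prod E = lebesgue_prod \<and>
     (\<exists>\<Psi>\<in>measurable lebesgue_prod lebesgue_prod. \<forall>x. \<Psi> (E x) = x)"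

lemma volume_iso_comp:
  assumes "volume_iso E" "volume_iso E'"
  shows "volume_iso (\<lambda>x. E (E' x))"
proof -
  obtain \<Psi> \<Psi>' where *[measurable]: "E \<in> measurable lebesgue_prod lebesgue_prod"
      "E' \<in> measurable lebesgue_prod lebesgue_prod"
      "\<Psi> \<in> measurable lebesgue_prod lebesgue_prod" "\<Psi>' \<in> measurable lebesgue_prod lebesgue_prod"
    and inv: "\<And>x. \<Psi> (E x) = x" "\<And>x. \<Psi>' (E' x) = x"
    and d: "distr lebesgue_prod lebesgue_prod E = lebesgue_prod"
      "distr lebesgue_prod lebesgue_prod E' = lebesgue_prod"
    using assms unfolding volume_iso_def by blast
  have "distr lebesgue_prod lebesgue_prod (\<lambda>x. E (E' x))
      = distr (distr lebesgue_prod lebesgue_prod E') lebesgue_prod E"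
    by (subst distr_distr) (auto simp: comp_def)
  then have "distr lebesgue_prod lebesgue_prod (\<lambda>x. E (E' x)) = lebesgue_prod"
    by (simp add: d)
  moreover have "(\<lambda>x. \<Psi>' (\<Psi> x)) \<in> measurable lebesgue_prod lebesgue_prod" by simp
  moreover have "\<forall>x. \<Psi>' (\<Psi> (E (E' x))) = x" by (simp add: inv)
  ultimately show ?thesis unfolding volume_iso_def by (intro conjI bexI) auto
qed

lemma volume_iso_id: "volume_iso (\<lambda>x. x)"
  unfolding volume_iso_def by (auto intro!: bexI[of _ "\<lambda>x. x"])

text \<open>By Fubini, integrate over coordinate \<open>j\<close> first. With the other coordinates
  fixed, \<open>m\<close> is constant and the map is a translation of the line.\<close>

lemma volume_iso_shear:
  fixes m :: "('n::finite \<Rightarrow> real) \<Rightarrow> real"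
  assumes m[measurable]: "m \<in> borel_measurable lebesgue_prod"
    and indep: "\<And>x y. m (x(j := y)) = m x"
  shows "volume_iso (\<lambda>x. x(j := x j - m x))"
proof -
  let ?L = "lebesgue_prod :: ('n \<Rightarrow> real) measure"
  let ?E = "\<lambda>x. x(j := x j - m x)" and ?\<Psi> = "\<lambda>x. x(j := x j + m x)"
  interpret product_sigma_finite "\<lambda>_::'n. lborel :: real measure" by (rule product_sigma_finite_lborel)
  have E[measurable]: "?E \<in> measurable ?L ?L"
    by (rule measurable_lebesgue_prodI) (simp add: fun_upd_def, measurable)
  have \<Psi>: "?\<Psi> \<in> measurable ?L ?L"
    by (rule measurable_lebesgue_prodI) (simp add: fun_upd_def, measurable)
  have "distr ?L ?L ?E = ?L"
  proof (rule measure_eqI)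
    fix A assume "A \<in> sets (distr ?L ?L ?E)"
    then have A[measurable]: "A \<in> sets ?L" by simp
    have ins: "insert j (UNIV - {j}) = (UNIV :: 'n set)" by auto
    have fold: "(\<integral>\<^sup>+x. f x \<partial>?L) = (\<integral>\<^sup>+x. \<integral>\<^sup>+y. f (x(j := y)) \<partial>lborel \<partial>(\<Pi>\<^sub>M i\<in>UNIV - {j}. lborel))"
      if "f \<in> borel_measurable ?L" for f
      using product_nn_integral_insert[of "UNIV - {j}" j f] that by (simp add: ins)
    have upd: "(\<lambda>y. indicator A (x(j := y)) :: ennreal) \<in> borel_measurable borel" for x
    proof -
      have "(\<lambda>y. x(j := y)) \<in> measurable borel ?L"
        by (rule measurable_lebesgue_prodI) (simp add: fun_upd_def)
      from measurable_compose[OF this borel_measurable_indicator[OF A]] show ?thesis .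
    qed
    have "emeasure (distr ?L ?L ?E) A = (\<integral>\<^sup>+x. indicator A x \<partial>distr ?L ?L ?E)"
      by (simp add: A)
    also have "\<dots> = (\<integral>\<^sup>+x. indicator A (?E x) \<partial>?L)"
      by (rule nn_integral_distr[OF E]) measurable
    also have "\<dots> = (\<integral>\<^sup>+x. \<integral>\<^sup>+y. indicator A (?E (x(j := y))) \<partial>lborel \<partial>(\<Pi>\<^sub>M i\<in>UNIV - {j}. lborel))"
      by (rule fold) measurable
    also have "\<dots> = (\<integral>\<^sup>+x. \<integral>\<^sup>+y. indicator A (x(j := y)) \<partial>lborel \<partial>(\<Pi>\<^sub>M i\<in>UNIV - {j}. lborel))"
    proof (rule nn_integral_cong)
      fix x :: "'n \<Rightarrow> real"
      show "(\<integral>\<^sup>+y. indicator A (?E (x(j := y))) \<partial>lborel) = (\<integral>\<^sup>+y. indicator A (x(j := y)) \<partial>lborel)"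
        using nn_integral_real_affine[OF upd[of x], of 1 "- m x"] by (simp add: indep)
    qed
    also have "\<dots> = (\<integral>\<^sup>+x. indicator A x \<partial>?L)"
      by (rule fold[symmetric]) measurable
    also have "\<dots> = emeasure ?L A" by (simp add: A)
    finally show "emeasure (distr ?L ?L ?E) A = emeasure ?L A" .
  qed simp
  then show ?thesis
    unfolding volume_iso_def using E \<Psi> by (auto simp: indep intro!: bexI[of _ ?\<Psi>])
qed

lemma volume_iso_triangular:
  fixes m :: "'n::finite \<Rightarrow> ('n \<Rightarrow> real) \<Rightarrow> real"
  assumes acyc: "acyclic r"
    and meas: "\<And>j. m j \<in> borel_measurable lebesgue_prod"
    and dep: "\<And>j x y. (\<And>i. (i, j) \<in> r \<Longrightarrow> x i = y i) \<Longrightarrow> m j x = m j y"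
    and closed: "r `` K \<subseteq> K"
  shows "volume_iso (\<lambda>x j. if j \<in> K then x j - m j x else x j)"
  using finite[of K] closed
proof (induction K rule: finite_psubset_induct)
  case (psubset K)
  show ?case
  proof (cases "K = {}")
    case True
    then show ?thesis by (simp add: volume_iso_id)
  next
    case False
    have "wf r" using acyc by (intro finite_acyclic_wf) auto
    then obtain z where z: "z \<in> K" "\<And>y. (y, z) \<in> r \<Longrightarrow> y \<notin> K"
      using False by (metis ex_in_conv wfE_min)
    let ?E = "\<lambda>K x j. if j \<in> K then x j - m j x else x j"
    have "volume_iso (?E (K - {z}))"
      using z psubset.prems by (intro psubset.IH) auto
    moreover have "volume_iso (\<lambda>x. x(z := x z - m z x))"
      using z by (intro volume_iso_shear meas dep) auto
    \<comment> \<open>No parent of \<open>z\<close> lies in \<open>K\<close>, so the substitution on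
      \<open>K - {z}\<close> leaves the arguments of \<open>m z\<close> unchanged and the shear at
      \<open>z\<close> can be applied last.\<close>
    moreover have "?E K = (\<lambda>x. (?E (K - {z}) x)(z := ?E (K - {z}) x z - m z (?E (K - {z}) x)))"
    proof -
      have "m z (?E (K - {z}) x) = m z x" for x by (rule dep) (use z in auto)
      then show ?thesis using z by (auto simp: fun_eq_iff)
    qed
    ultimately show ?thesis using volume_iso_comp[of "\<lambda>x. x(z := x z - m z x)" "?E (K - {z})"] by simp
  qed
qed

text \<open>\<open>noise S\<close> maps a value of \<open>X\<close> to the value of \<open>(\<epsilon>\<^sub>1, \<dots>, \<epsilon>\<^sub>p)\<close>; unlike \<open>plsem_fun\<close> it is not
  normalised by \<open>sig\<close> and acts on functions, where Lebesgue measure is literally a product.\<close>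

definition noise :: "('n::finite) plsem \<Rightarrow> ('n \<Rightarrow> real) \<Rightarrow> 'n \<Rightarrow> real" where
  "noise S x j = x j - (mu S j + (\<Sum>i\<in>pa S j. fns S j i (x i)))"

lemma C2_continuous: "C2 g \<Longrightarrow> continuous_on UNIV g"
  unfolding C2_def by (meson DERIV_isCont continuous_at_imp_continuous_on)

lemma plsem_wf_continuous: "plsem_wf S \<Longrightarrow> i \<in> pa S j \<Longrightarrow> continuous_on UNIV (fns S j i)"
  by (auto simp: plsem_wf_def pa_def intro: C2_continuous)

lemma volume_iso_noise:
  assumes "plsem_wf S"
  shows "volume_iso (noise S)"
proof -
  have "(\<lambda>x. mu S j + (\<Sum>i\<in>pa S j. fns S j i (x i))) \<in> borel_measurable lebesgue_prod" for j
  proof (intro borel_measurable_add borel_measurable_const borel_measurable_sum)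
    fix i assume "i \<in> pa S j"
    then have "fns S j i \<in> borel_measurable borel"
      by (intro borel_measurable_continuous_onI plsem_wf_continuous[OF assms])
    moreover have "(\<lambda>x. x i) \<in> measurable lebesgue_prod (borel :: real measure)"
      using measurable_component_singleton[of i UNIV "\<lambda>_. lborel :: real measure"] by simp
    ultimately show "(\<lambda>x. fns S j i (x i)) \<in> borel_measurable lebesgue_prod"
      by (rule measurable_compose[rotated])
  qed
  note meas = this
  have dep: "mu S j + (\<Sum>i\<in>pa S j. fns S j i (x i)) = mu S j + (\<Sum>i\<in>pa S j. fns S j i (y i))"
    if "\<And>i. (i, j) \<in> dag S \<Longrightarrow> x i = y i" for j and x y :: "'a \<Rightarrow> real"
    using that by (simp add: pa_def)
  have "acyclic (dag S)" using assms by (simp add: plsem_wf_def)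
  then have "volume_iso (\<lambda>x j. if j \<in> UNIV then x j - (mu S j + (\<Sum>i\<in>pa S j. fns S j i (x i))) else x j)"
    by (rule volume_iso_triangular[OF _ meas dep subset_UNIV])
  then show ?thesis unfolding noise_def[abs_def] by simp
qed

section \<open>Joint densities of the noise and of X\<close>

lemma PiM_density_lborel:
  fixes g :: "'n::finite \<Rightarrow> real \<Rightarrow> real"
  assumes meas: "\<And>i. g i \<in> borel_measurable borel" and nonneg: "\<And>i x. 0 \<le> g i x"
    and prob: "\<And>i. prob_space (density lborel (g i))"
  shows "(\<Pi>\<^sub>M i\<in>UNIV. density lborel (g i)) = density lebesgue_prod (\<lambda>x. \<Prod>i\<in>UNIV. g i (x i))"
proof -
  note meas[measurable]
  interpret L: product_sigma_finite "\<lambda>_::'n. lborel :: real measure" by (rule product_sigma_finite_lborel)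
  interpret D: product_sigma_finite "\<lambda>i. density lborel (g i)"
    using prob by (intro product_sigma_finite.intro prob_space_imp_sigma_finite)
  have "density lebesgue_prod (\<lambda>x. \<Prod>i\<in>UNIV. g i (x i)) = (\<Pi>\<^sub>M i\<in>UNIV. density lborel (g i))"
  proof (rule D.PiM_eqI)
    show "sets (density lebesgue_prod (\<lambda>x. \<Prod>i\<in>UNIV. g i (x i))) = sets (\<Pi>\<^sub>M i\<in>UNIV. density lborel (g i))"
      by (simp cong: sets_PiM_cong)
    fix A assume "\<And>i. i \<in> UNIV \<Longrightarrow> A i \<in> sets (density lborel (g i))"
    then have A[measurable]: "A i \<in> sets borel" for i by simp
    have "emeasure (density lebesgue_prod (\<lambda>x. \<Prod>i\<in>UNIV. g i (x i))) (Pi\<^sub>E UNIV A)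
        = (\<integral>\<^sup>+x. ennreal (\<Prod>i\<in>UNIV. g i (x i)) * indicator (Pi\<^sub>E UNIV A) x \<partial>lebesgue_prod)"
      by (rule emeasure_density) (auto intro!: sets_PiM_I_finite)
    also have "\<dots> = (\<integral>\<^sup>+x. (\<Prod>i\<in>UNIV. ennreal (g i (x i)) * indicator (A i) (x i)) \<partial>lebesgue_prod)"
    proof (rule nn_integral_cong)
      fix x :: "'n \<Rightarrow> real"
      have "(indicator (Pi\<^sub>E UNIV A) x :: ennreal) = (\<Prod>i\<in>UNIV. indicator (A i) (x i))"
        by (auto simp: indicator_def PiE_iff prod_zero_iff)
      then show "ennreal (\<Prod>i\<in>UNIV. g i (x i)) * indicator (Pi\<^sub>E UNIV A) x
          = (\<Prod>i\<in>UNIV. ennreal (g i (x i)) * indicator (A i) (x i))"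
        by (simp add: prod.distrib prod_ennreal nonneg)
    qed
    also have "\<dots> = (\<Prod>i\<in>UNIV. \<integral>\<^sup>+y. ennreal (g i y) * indicator (A i) y \<partial>lborel)"
      by (rule L.product_nn_integral_prod) auto
    also have "\<dots> = (\<Prod>i\<in>UNIV. emeasure (density lborel (g i)) (A i))"
      by (simp add: emeasure_density)
    finally show "emeasure (density lebesgue_prod (\<lambda>x. \<Prod>i\<in>UNIV. g i (x i))) (Pi\<^sub>E UNIV A)
        = (\<Prod>i\<in>UNIV. emeasure (density lborel (g i)) (A i))" .
  qed simp
  then show ?thesis by simp
qed

definition noise_density :: "('n::finite) plsem \<Rightarrow> ('n \<Rightarrow> real) \<Rightarrow> real" where
  "noise_density S x = (\<Prod>j\<in>UNIV. normal_density 0 (sig S j) (x j))"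

lemma generates_density:
  fixes S :: "('n::finite) plsem"
  assumes "generates S P"
  shows "distr P lebesgue_prod vec_nth = density lebesgue_prod (\<lambda>x. noise_density S (noise S x))"
proof -
  let ?L = "lebesgue_prod :: ('n \<Rightarrow> real) measure"
  obtain M :: "(real^'n) measure" and eps X where wf: "plsem_wf S"
    and M: "prob_space M" and ind: "prob_space.indep_vars M (\<lambda>_. borel) eps UNIV"
    and eps[measurable]: "\<And>j. eps j \<in> borel_measurable M"
    and law: "\<And>j. distr M lborel (eps j) = density lborel (normal_density 0 (sig S j))"
    and X[measurable]: "X \<in> borel_measurable M"
    and eq: "\<And>\<omega> j. \<omega> \<in> space M \<Longrightarrow>
        X \<omega> $ j = mu S j + (\<Sum>i\<in>pa S j. fns S j i (X \<omega> $ i)) + eps j \<omega>"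
    and P: "P = distr M borel X"
    using assms unfolding generates_def by blast
  interpret prob_space M by (rule M)
  have pos: "0 < sig S j" for j using wf by (simp add: plsem_wf_def)
  have [measurable]: "noise_density S \<in> borel_measurable ?L"
    unfolding noise_density_def[abs_def] by measurable
  obtain \<Psi> where E[measurable]: "noise S \<in> measurable ?L ?L" and \<Psi>[measurable]: "\<Psi> \<in> measurable ?L ?L"
    and pres: "distr ?L ?L (noise S) = ?L" and inv: "\<And>x. \<Psi> (noise S x) = x"
    using volume_iso_noise[OF wf] unfolding volume_iso_def by blast
  have e[measurable]: "(\<lambda>\<omega> j. eps j \<omega>) \<in> measurable M ?L"
    by (rule measurable_lebesgue_prodI) simp
  have nth[measurable]: "vec_nth \<in> measurable (borel :: (real^'n) measure) ?L"
    by (rule measurable_lebesgue_prodI) simp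
  have "distr M ?L (\<lambda>\<omega> j. eps j \<omega>) = distr M (\<Pi>\<^sub>M i\<in>UNIV. borel) (\<lambda>\<omega>. \<lambda>j\<in>UNIV. eps j \<omega>)"
    by (rule distr_cong) (auto cong: sets_PiM_cong)
  also have "\<dots> = (\<Pi>\<^sub>M j\<in>UNIV. distr M borel (eps j))"
    using ind by (subst (asm) indep_vars_iff_distr_eq_PiM) auto
  also have "\<dots> = (\<Pi>\<^sub>M j\<in>UNIV. density lborel (normal_density 0 (sig S j)))"
    unfolding law[symmetric] by (intro PiM_cong distr_cong) auto
  also have "\<dots> = density ?L (noise_density S)"
    unfolding noise_density_def[abs_def] using pos
    by (intro PiM_density_lborel prob_space_normal_density) auto
  finally have law_e: "distr M ?L (\<lambda>\<omega> j. eps j \<omega>) = density ?L (noise_density S)" .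
  have "distr P ?L vec_nth = distr M ?L (\<lambda>\<omega>. vec_nth (X \<omega>))"
    unfolding P by (subst distr_distr) (auto simp: comp_def)
  \<comment> \<open>The structural equations say that \<open>noise S\<close> maps X to the noise
    vector, so X is \<open>\<Psi>\<close> of that vector.\<close>
  also have "\<dots> = distr M ?L (\<lambda>\<omega>. \<Psi> (\<lambda>j. eps j \<omega>))"
  proof (rule distr_cong)
    fix \<omega> assume "\<omega> \<in> space M"
    then have "noise S (vec_nth (X \<omega>)) = (\<lambda>j. eps j \<omega>)"
      by (auto simp: noise_def fun_eq_iff eq)
    then show "vec_nth (X \<omega>) = \<Psi> (\<lambda>j. eps j \<omega>)" using inv by metis
  qed auto
  also have "\<dots> = distr (density ?L (noise_density S)) ?L \<Psi>"
    unfolding law_e[symmetric] by (subst distr_distr) (auto simp: comp_def)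
  \<comment> \<open>Lebesgue measure is rewritten as its own image under \<open>noise S\<close>, so
    that the density can be pulled back along \<open>noise S\<close>; the two push-forwards then
    cancel.\<close>
  also have "\<dots> = distr (density (distr ?L ?L (noise S)) (noise_density S)) ?L \<Psi>"
    by (simp add: pres)
  also have "\<dots> = distr (distr (density ?L (\<lambda>x. noise_density S (noise S x))) ?L (noise S)) ?L \<Psi>"
    by (subst density_distr) auto
  also have "\<dots> = distr (density ?L (\<lambda>x. noise_density S (noise S x))) ?L (\<lambda>x. x)"
    by (subst distr_distr) (auto simp: comp_def inv)
  also have "\<dots> = density ?L (\<lambda>x. noise_density S (noise S x))"
    by (rule distr_id2) simp
  finally show ?thesis .
qed

text \<open>The set where \<open>g\<close> and \<open>h\<close> differ is open. If it contained
  \<open>x\<close>, it would contain an open box around \<open>x\<close>, whose measure is a product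
  of positive factors.\<close>

lemma AE_lebesgue_prod_continuous_eq:
  fixes g h :: "real^'n::finite \<Rightarrow> real"
  assumes "continuous_on UNIV g" "continuous_on UNIV h"
    and AE: "AE x in lebesgue_prod. g (vec_lambda x) = h (vec_lambda x)"
  shows "g x = h x"
proof (rule ccontr)
  interpret product_sigma_finite "\<lambda>_::'n. lborel :: real measure" by (rule product_sigma_finite_lborel)
  assume "g x \<noteq> h x"
  moreover have "open {x. g x \<noteq> h x}" by (rule open_Collect_neq) (use assms in auto)
  ultimately obtain A where "\<forall>i. open (A i) \<and> x $ i \<in> A i"
    and "\<forall>y. (\<forall>i. y $ i \<in> A i) \<longrightarrow> y \<in> {x. g x \<noteq> h x}"
    unfolding open_vec_def by blast
  then have A: "\<And>i. open (A i)" "\<And>i. x $ i \<in> A i"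
    and sub: "\<And>y. (\<And>i. y $ i \<in> A i) \<Longrightarrow> g y \<noteq> h y"
    by simp_all
  have pos: "emeasure lborel (A i) \<noteq> 0" for i
  proof -
    obtain e where e: "0 < e" "ball (x $ i) e \<subseteq> A i" using A[of i] openE by metis
    then have "{x $ i - e<..<x $ i + e} \<subseteq> A i" by (simp add: ball_eq_greaterThanLessThan)
    then have "emeasure lborel {x $ i - e<..<x $ i + e} \<le> emeasure lborel (A i)"
      using A by (intro emeasure_mono) auto
    then show ?thesis using e by auto
  qed
  have meas: "Pi\<^sub>E UNIV A \<in> sets lebesgue_prod" using A by (intro sets_PiM_I_finite) auto
  have "AE y in lebesgue_prod. y \<notin> Pi\<^sub>E UNIV A"
    using AE
  proof eventually_elim
    case (elim y)
    then show ?case using sub[of "vec_lambda y"] by (auto simp: PiE_iff)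
  qed
  then have "emeasure lebesgue_prod (Pi\<^sub>E UNIV A) = 0"
    using meas AE_iff_measurable[of "Pi\<^sub>E UNIV A" lebesgue_prod "\<lambda>y. y \<notin> Pi\<^sub>E UNIV A"]
    by (auto simp: space_PiM)
  then have "(\<Prod>i\<in>UNIV. emeasure lborel (A i)) = 0"
    using A by (subst (asm) emeasure_PiM) auto
  then show False using pos by (simp add: prod_zero_iff)
qed

text \<open>Each noise coordinate is \<open>sig S j\<close> times the coordinate of the
  PLSEM-function, so the variances cancel in the exponents and survive only in a factor independent
  of \<open>x\<close>.\<close>

lemma noise_density_plsem_fun:
  assumes "plsem_wf S"
  shows "noise_density S (noise S (vec_nth x)) =
    (\<Prod>j\<in>UNIV. 1 / sqrt (2 * pi * (sig S j)\<^sup>2)) * exp (- (plsem_fun S x \<bullet> plsem_fun S x) / 2)"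
proof -
  have pos: "0 < sig S j" for j using assms by (simp add: plsem_wf_def)
  have n: "noise S (vec_nth x) j = sig S j * plsem_fun S x $ j" for j
    using pos[of j] by (simp add: noise_def plsem_fun_def)
  have "normal_density 0 (sig S j) (noise S (vec_nth x) j) =
      1 / sqrt (2 * pi * (sig S j)\<^sup>2) * exp (- (plsem_fun S x $ j * plsem_fun S x $ j) / 2)" for j
    using pos[of j] unfolding n normal_density_def by (simp add: power2_eq_square)
  then have "noise_density S (noise S (vec_nth x)) = (\<Prod>j\<in>UNIV. 1 / sqrt (2 * pi * (sig S j)\<^sup>2)) *
      (\<Prod>j\<in>UNIV. exp (- (plsem_fun S x $ j * plsem_fun S x $ j) / 2))"
    unfolding noise_density_def prod.distrib[symmetric] by simp
  also have "(\<Prod>j\<in>UNIV. exp (- (plsem_fun S x $ j * plsem_fun S x $ j) / 2)) =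
      exp (- (plsem_fun S x \<bullet> plsem_fun S x) / 2)"
    by (simp add: exp_sum[symmetric] inner_vec_def sum_negf sum_divide_distrib)
  finally show ?thesis .
qed

lemma plsem_fun_continuous:
  assumes "plsem_wf S"
  shows "continuous_on UNIV (plsem_fun S)"
proof -
  have "continuous_on UNIV (\<lambda>x. plsem_fun S x $ j)" for j
  proof -
    have "sig S j \<noteq> 0" using assms by (simp add: plsem_wf_def less_imp_neq[symmetric])
    moreover have "continuous_on UNIV (\<lambda>x. fns S j i (x $ i))" if "i \<in> pa S j" for i
      by (rule continuous_on_compose2[OF plsem_wf_continuous[OF assms that]])
        (auto intro!: continuous_intros)
    ultimately show ?thesis
      unfolding plsem_fun_def by (auto intro!: continuous_intros)
  qed
  then show ?thesis by (rule continuous_on_vec_lambda[of _ "\<lambda>j x. plsem_fun S x $ j", simplified])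
qed

text \<open>Both PLSEMs give densities of the same law, which agree almost everywhere and hence,
  being continuous, everywhere. Taking logarithms leaves \<open>d\<close> as twice the log ratio of
  the normalising constants.\<close>

lemma plsem_fun_norm_diff_const:
  assumes S: "generates S P" and T: "generates T P"
  obtains d where "\<And>x. plsem_fun S x \<bullet> plsem_fun S x = plsem_fun T x \<bullet> plsem_fun T x + d"
proof -
  have wf: "plsem_wf S" "plsem_wf T" using S T by (auto simp: generates_def)
  have nonneg: "0 \<le> noise_density S x" for S :: "'a plsem" and x
    by (simp add: noise_density_def prod_nonneg)
  have meas: "(\<lambda>x. ennreal (noise_density S (noise S x))) \<in> borel_measurable lebesgue_prod"
    if "plsem_wf S" for S :: "'a plsem"
  proof -
    have [measurable]: "noise S \<in> measurable lebesgue_prod lebesgue_prod"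
      using volume_iso_noise[OF that] by (simp add: volume_iso_def)
    have [measurable]: "noise_density S \<in> borel_measurable lebesgue_prod"
      unfolding noise_density_def[abs_def] by measurable
    show ?thesis by measurable
  qed
  have "density lebesgue_prod (\<lambda>x. ennreal (noise_density S (noise S x))) =
      density lebesgue_prod (\<lambda>x. ennreal (noise_density T (noise T x)))"
    using generates_density[OF S] generates_density[OF T] by simp
  then have "AE x in lebesgue_prod. ennreal (noise_density S (noise S x)) = ennreal (noise_density T (noise T x))"
    by (rule sigma_finite_measure.density_unique[OF sigma_finite_lebesgue_prod meas[OF wf(1)] meas[OF wf(2)]])
  then have "AE x in lebesgue_prod. noise_density S (noise S (vec_nth (vec_lambda x)))
      = noise_density T (noise T (vec_nth (vec_lambda x)))"
    by (simp add: nonneg vec_lambda_inverse)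
  then have eq: "noise_density S (noise S (vec_nth x)) = noise_density T (noise T (vec_nth x))" for x
    by (rule AE_lebesgue_prod_continuous_eq[rotated 2])
      (auto simp: noise_density_plsem_fun wf intro!: continuous_intros plsem_fun_continuous)
  define k :: "'a plsem \<Rightarrow> real" where "k S = (\<Prod>j\<in>UNIV. 1 / sqrt (2 * pi * (sig S j)\<^sup>2))" for S
  have k: "0 < k S" if "plsem_wf S" for S
    unfolding k_def using that
    by (auto simp: plsem_wf_def intro!: prod_pos divide_pos_pos mult_pos_pos zero_less_power)
  have "plsem_fun S x \<bullet> plsem_fun S x = plsem_fun T x \<bullet> plsem_fun T x + 2 * (ln (k S) - ln (k T))" for x
  proof -
    have "ln (k S * exp (- (plsem_fun S x \<bullet> plsem_fun S x) / 2))
        = ln (k T * exp (- (plsem_fun T x \<bullet> plsem_fun T x) / 2))"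
      using eq[of x] by (simp add: noise_density_plsem_fun wf k_def)
    then show ?thesis using k[OF wf(1)] k[OF wf(2)] by (simp add: ln_mult)
  qed
  then show thesis by (rule that)
qed

section \<open>PLSEM-functions\<close>

lemma plsem_fun_additive: "additive_in_coords (plsem_fun S)"
  unfolding additive_in_coords_def
proof (intro allI)
  fix x
  \<comment> \<open>The point \<open>axis k (x $ k)\<close> differs from the origin at most in
    coordinate \<open>k\<close>, so only the summand \<open>k = i\<close> survives.\<close>
  have delta: "(\<Sum>k\<in>UNIV. h k (axis k (x $ k) $ i) - h k (0::real)) = h i (x $ i) - h i 0"
    for h :: "'a \<Rightarrow> real \<Rightarrow> real" and i
    by (subst sum.remove[of _ i]) (auto intro!: sum.neutral simp: axis_def)
  have split: "(\<Sum>k\<in>UNIV. u k / c - (\<Sum>i\<in>I. g i k) / c) = sum u UNIV / c - (\<Sum>i\<in>I. \<Sum>k\<in>UNIV. g i k) / c"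
    for u :: "'a \<Rightarrow> real" and g :: "'a \<Rightarrow> 'a \<Rightarrow> real" and c I
    by (subst sum.swap) (simp add: sum_subtractf sum_divide_distrib)
  have "plsem_fun S x $ j =
     (plsem_fun S 0 + (\<Sum>k\<in>UNIV. plsem_fun S (axis k (x $ k)) - plsem_fun S 0)) $ j" for j
  proof -
    have "(\<Sum>k\<in>UNIV. plsem_fun S (axis k (x $ k)) $ j - plsem_fun S 0 $ j) =
        (\<Sum>k\<in>UNIV. (axis k (x $ k) $ j - 0) / sig S j
          - (\<Sum>i\<in>pa S j. fns S j i (axis k (x $ k) $ i) - fns S j i 0) / sig S j)"
      by (intro sum.cong refl) (simp add: plsem_fun_def diff_divide_distrib sum_subtractf)
    also have "\<dots> = (\<Sum>k\<in>UNIV. axis k (x $ k) $ j - 0) / sig S j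
        - (\<Sum>i\<in>pa S j. \<Sum>k\<in>UNIV. fns S j i (axis k (x $ k) $ i) - fns S j i 0) / sig S j"
      by (rule split)
    also have "\<dots> = x $ j / sig S j - (\<Sum>i\<in>pa S j. fns S j i (x $ i) - fns S j i 0) / sig S j"
      using delta[of "\<lambda>_ u. u" j] delta[of "\<lambda>_. fns S j _"] by simp
    finally have "(plsem_fun S 0 + (\<Sum>k\<in>UNIV. plsem_fun S (axis k (x $ k)) - plsem_fun S 0)) $ j =
        plsem_fun S 0 $ j + (x $ j / sig S j - (\<Sum>i\<in>pa S j. fns S j i (x $ i) - fns S j i 0) / sig S j)"
      by simp
    then show ?thesis
      by (simp add: plsem_fun_def diff_divide_distrib sum_subtractf)
  qed
  then show "plsem_fun S x = plsem_fun S 0 + (\<Sum>k\<in>UNIV. plsem_fun S (axis k (x $ k)) - plsem_fun S 0)"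
    by (simp add: vec_eq_iff)
qed

text \<open>Varying \<open>x $ k\<close> alone enters equation \<open>k\<close> as
  \<open>t / sig S k\<close> and otherwise only the equations of the children of \<open>k\<close>,
  through their edge functions. The slope is therefore \<open>1 / sig S k\<close>.\<close>

lemma plsem_fun_triangular:
  assumes wf: "plsem_wf S"
  shows "triangular (dag S) (\<lambda>k t. plsem_fun S (axis k t) - plsem_fun S 0)"
  unfolding triangular_def
proof (intro conjI allI)
  show "acyclic (dag S)" using wf by (simp add: plsem_wf_def)
  fix k
  let ?A = "\<lambda>t. plsem_fun S (axis k t) - plsem_fun S 0"
  have pos: "sig S j > 0" for j using wf by (simp add: plsem_wf_def)
  have "?A t - (1 / sig S k * t) *\<^sub>R axis k 1 \<in> span ((\<lambda>j. axis j 1) ` dag S `` {k})" for t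
  proof -
    define y where "y = ?A t - (1 / sig S k * t) *\<^sub>R axis k 1"
    have "y $ j = 0" if "(k, j) \<notin> dag S" for j
    proof -
      have "(\<Sum>i\<in>pa S j. fns S j i (axis k t $ i)) = (\<Sum>i\<in>pa S j. fns S j i 0)"
        using that by (intro sum.cong) (auto simp: pa_def axis_def)
      then show ?thesis
        by (cases "j = k") (auto simp: y_def plsem_fun_def axis_def diff_divide_distrib)
    qed
    then have "y = (\<Sum>j\<in>dag S `` {k}. (y $ j) *\<^sub>R axis j 1)"
      by (auto simp: vec_eq_iff axis_def if_distrib cong: if_cong)
    also have "\<dots> \<in> span ((\<lambda>j. axis j 1) ` dag S `` {k})"
      by (intro span_sum span_scale span_base) auto
    finally show ?thesis by (simp add: y_def)
  qed
  then show "\<exists>c. c \<noteq> 0 \<and> (\<forall>t. ?A t - (c * t) *\<^sub>R axis k 1 \<in> span ((\<lambda>j. axis j 1) ` dag S `` {k}))"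
    using pos[of k] by (intro exI[of _ "1 / sig S k"]) simp
qed

theorem mainTheorem3:
  fixes P :: "(real^'n::finite) measure" and F :: "real^'n \<Rightarrow> real^'n"
  assumes "generated_by_plsem P"
    and "F \<in> plsem_funs P"
  shows "\<exists>Os \<subseteq> {Q :: real^'n^'n. Q ** transpose Q = mat 1}.
           plsem_funs P = {(\<lambda>x. Q *v F x) | Q. Q \<in> Os}"
proof -
  obtain S where S: "generates S P" and F: "F = plsem_fun S"
    using assms(2) by (auto simp: plsem_funs_def)
  \<comment> \<open>Taking all orthogonal matrices that send \<open>F\<close> into
    \<open>plsem_funs P\<close> makes one inclusion hold by definition; what remains is that each
    \<open>G\<close> is reached.\<close>
  let ?Os = "{Q :: real^'n^'n. Q ** transpose Q = mat 1 \<and> (\<lambda>x. Q *v F x) \<in> plsem_funs P}"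
  have "\<exists>Q \<in> ?Os. G = (\<lambda>x. Q *v F x)" if G: "G \<in> plsem_funs P" for G
  proof -
    obtain T where T: "generates T P" and GT: "G = plsem_fun T"
      using G by (auto simp: plsem_funs_def)
    obtain d where "\<And>x. plsem_fun S x \<bullet> plsem_fun S x = plsem_fun T x \<bullet> plsem_fun T x + d"
      using plsem_fun_norm_diff_const[OF S T] by blast
    moreover have "plsem_wf S" "plsem_wf T" using S T by (simp_all add: generates_def)
    ultimately obtain U where U: "orthogonal_transformation U" and GU: "\<And>x. G x = U (F x)"
      unfolding F GT
      using triangular_additive_orthogonal[OF plsem_fun_additive plsem_fun_additive
          plsem_fun_triangular plsem_fun_triangular] by metis
    then have "linear U" and "orthogonal_matrix (matrix U)"
      by (simp_all add: orthogonal_transformation_matrix)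
    then have "matrix U ** transpose (matrix U) = mat 1" and eq: "G = (\<lambda>x. matrix U *v F x)"
      by (auto simp: orthogonal_matrix_def matrix_works GU)
    then have "matrix U \<in> ?Os" using G by simp
    then show ?thesis using eq by blast
  qed
  then have "plsem_funs P = {(\<lambda>x. Q *v F x) | Q. Q \<in> ?Os}" by blast
  then show ?thesis by (intro exI[of _ ?Os] conjI) auto
qed

end
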